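(* Let $n\ge2$ be an integer, $\pi\in\mathfrak S_n$, $r\in(0,\binom n2]$ a real number, and let $\mathcal B(\pi,r)=\{\sigma\in\mathfrak S_n: d_{\mathsf{KT}}(\pi,\sigma)\le r\}$. Then for every $\varepsilon\in(0,r)$, $$n\log\Big(\frac{r}{n+\varepsilon}\Big)-2n\ \le\ \log N(\mathcal B(\pi,r),\varepsilon)\ \le\ \log D(\mathcal B(\pi,r),\varepsilon)\ \le\ n\log\Big(\frac{2n+2r}{\varepsilon}\Big)+2n .$$
   Context: $\mathfrak S_n$ is the set of permutations of $[n]=\{1,\dots,n\}$ with the Kendall tau distance $d_{\mathsf{KT}}(\pi,\sigma)=\sum_{(i,j):\sigma(i)<\sigma(j)}\mathbf 1(\pi(i)>\pi(j))$. For $S\subseteq\mathfrak S_n$ and $\varepsilon>0$, $N(S,\varepsilon)$ is the $\varepsilon$-covering number of $S$ (the smallest cardinality of a subset $\mathcal N\subseteq S$ such that every element of $S$ is within distance $\le\varepsilon$ of some element of $\mathcal N$), and $D(S,\varepsilon)$ is the $\varepsilon$-packing number of $S$ (the largest cardinality of a subset of $S$ whose distinct elements are pairwise at distance $>\varepsilon$), both with respect to $d_{\mathsf{KT}}$. $\log$ is the natural logarithm. *)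

theory Defs
  imports Complex_Main "HOL-Combinatorics.Permutations"
begin

definition perms :: "nat \<Rightarrow> (nat \<Rightarrow> nat) set" where
  "perms n = {\<pi>. \<pi> permutes {1..n}}"

definition kendall_tau :: "nat \<Rightarrow> (nat \<Rightarrow> nat) \<Rightarrow> (nat \<Rightarrow> nat) \<Rightarrow> real" where
  "kendall_tau n \<pi> \<sigma> =
     (\<Sum>(i, j) \<in> {(i, j). i \<in> {1..n} \<and> j \<in> {1..n} \<and> \<sigma> i < \<sigma> j}. of_bool (\<pi> i > \<pi> j))"

definition kt_ball :: "nat \<Rightarrow> (nat \<Rightarrow> nat) \<Rightarrow> real \<Rightarrow> (nat \<Rightarrow> nat) set" where
  "kt_ball n \<pi> r = {\<sigma> \<in> perms n. kendall_tau n \<pi> \<sigma> \<le> r}"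

definition is_cover :: "('a \<Rightarrow> 'a \<Rightarrow> real) \<Rightarrow> 'a set \<Rightarrow> real \<Rightarrow> 'a set \<Rightarrow> bool" where
  "is_cover d S \<epsilon> C \<longleftrightarrow> C \<subseteq> S \<and> (\<forall>x\<in>S. \<exists>y\<in>C. d x y \<le> \<epsilon>)"

definition is_packing :: "('a \<Rightarrow> 'a \<Rightarrow> real) \<Rightarrow> 'a set \<Rightarrow> real \<Rightarrow> 'a set \<Rightarrow> bool" where
  "is_packing d S \<epsilon> P \<longleftrightarrow> P \<subseteq> S \<and> (\<forall>x\<in>P. \<forall>y\<in>P. x \<noteq> y \<longrightarrow> d x y > \<epsilon>)"

(* Both numbers are meant for finite S only, where the minimum and the maximum are attained
   (every set of permutations of {1..n} is finite). *)

definition covering_number :: "('a \<Rightarrow> 'a \<Rightarrow> real) \<Rightarrow> 'a set \<Rightarrow> real \<Rightarrow> nat" where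
  "covering_number d S \<epsilon> = Min {card C | C. is_cover d S \<epsilon> C}"

definition packing_number :: "('a \<Rightarrow> 'a \<Rightarrow> real) \<Rightarrow> 'a set \<Rightarrow> real \<Rightarrow> nat" where
  "packing_number d S \<epsilon> = Max {card P | P. is_packing d S \<epsilon> P}"

end

(* The Kendall tau distance is right invariant, so all balls of a given radius have the same
   cardinality, and Lehmer codes identify the ball of radius m around the identity with the set of
   all a with 0 \<le> a i < i for i = 1, ..., n and total at most m. An exponential moment bound gives
   the upper estimate e^n (1 + m/n)^n for the number of such a; restricting every entry to be at most
   m/n gives a lower estimate (m/n)^n exp(-(m/n + 1)). The bounds on the covering and packing numbers
   follow by comparing volumes. For the packing number the larger ball has radius r + \<epsilon>/2, and the
   saving of exp(-(m/n + 1)) over the more common exp(-n) pays for the extra \<epsilon>/2. *)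

theory Submission
  imports Defs "HOL-Library.FuncSet"
begin

section \<open>Covering and packing numbers of finite sets\<close>

lemma finite_cover_cards:
  assumes "finite S"
  shows "finite {card C | C. is_cover d S \<epsilon> C}"
proof -
  have "{card C | C. is_cover d S \<epsilon> C} \<subseteq> card ` Pow S"
    by (auto simp: is_cover_def)
  then show ?thesis using assms finite_subset by blast
qed

lemma finite_packing_cards:
  assumes "finite S"
  shows "finite {card P | P. is_packing d S \<epsilon> P}"
proof -
  have "{card P | P. is_packing d S \<epsilon> P} \<subseteq> card ` Pow S"
    by (auto simp: is_packing_def)
  then show ?thesis using assms finite_subset by blast
qed

text \<open>\<open>Min\<close> says nothing about an empty set, so a cover must be exhibited:
  \<open>S\<close> covers itself as soon as each point is within \<epsilon> of itself.\<close>

lemma covering_number_attained: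
  assumes "finite S" "\<And>x. x \<in> S \<Longrightarrow> d x x \<le> \<epsilon>"
  obtains C where "is_cover d S \<epsilon> C" "card C = covering_number d S \<epsilon>"
proof -
  have "is_cover d S \<epsilon> S" using assms(2) by (auto simp: is_cover_def)
  then have "{card C | C. is_cover d S \<epsilon> C} \<noteq> {}" by blast
  from Min_in[OF finite_cover_cards[OF assms(1)] this] that show ?thesis
    unfolding covering_number_def by auto
qed

lemma packing_number_attained:
  assumes "finite S"
  obtains P where "is_packing d S \<epsilon> P" "card P = packing_number d S \<epsilon>"
proof -
  have "is_packing d S \<epsilon> {}" by (auto simp: is_packing_def)
  then have "{card P | P. is_packing d S \<epsilon> P} \<noteq> {}" by blast
  from Max_in[OF finite_packing_cards[OF assms(1)] this] that show ?thesis
    unfolding packing_number_def by auto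
qed

text \<open>A packing of maximal size is a cover, since a point farther than \<epsilon> from all its
  members could be added to it. Symmetry gives the packing condition for the new point in both
  orders.\<close>

lemma covering_number_le_packing_number:
  assumes "finite S" and refl: "\<And>x. x \<in> S \<Longrightarrow> d x x \<le> \<epsilon>"
    and sym: "\<And>x y. x \<in> S \<Longrightarrow> y \<in> S \<Longrightarrow> d x y = d y x"
  shows "covering_number d S \<epsilon> \<le> packing_number d S \<epsilon>"
proof -
  obtain P where P: "is_packing d S \<epsilon> P" "card P = packing_number d S \<epsilon>"
    using packing_number_attained[OF assms(1)] by blast
  have fin: "finite P" using P(1) assms(1) finite_subset by (auto simp: is_packing_def)
  have "is_cover d S \<epsilon> P"
  proof (rule ccontr)
    assume "\<not> is_cover d S \<epsilon> P"
    then obtain x where x: "x \<in> S" "\<And>y. y \<in> P \<Longrightarrow> d x y > \<epsilon>"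
      using P(1) unfolding is_cover_def is_packing_def by force
    have "x \<notin> P" using x refl by force
    have "is_packing d S \<epsilon> (insert x P)"
      using P(1) x sym unfolding is_packing_def by (auto, metis subsetD)
    then have "card (insert x P) \<le> packing_number d S \<epsilon>"
      unfolding packing_number_def
      by (intro Max_ge finite_packing_cards[OF assms(1)]) blast
    then show False using \<open>x \<notin> P\<close> fin P(2) by simp
  qed
  then have "covering_number d S \<epsilon> \<le> card P"
    unfolding covering_number_def
    by (intro Min_le finite_cover_cards[OF assms(1)]) blast
  then show ?thesis using P(2) by simp
qed

section \<open>The Kendall tau distance\<close>

text \<open>With the distance written as the size of a set, its metric properties become inclusions
  and bijections between sets of pairs.\<close>

definition discordant :: "nat \<Rightarrow> (nat \<Rightarrow> nat) \<Rightarrow> (nat \<Rightarrow> nat) \<Rightarrow> (nat \<times> nat) set" where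
  "discordant n \<pi> \<sigma> = {(i, j). i \<in> {1..n} \<and> j \<in> {1..n} \<and> \<sigma> i < \<sigma> j \<and> \<pi> i > \<pi> j}"

lemma finite_discordant: "finite (discordant n \<pi> \<sigma>)"
  by (rule finite_subset[of _ "{1..n} \<times> {1..n}"]) (auto simp: discordant_def)

lemma kendall_tau_eq_card: "kendall_tau n \<pi> \<sigma> = real (card (discordant n \<pi> \<sigma>))"
proof -
  let ?A = "{(i, j). i \<in> {1..n} \<and> j \<in> {1..n} \<and> \<sigma> i < \<sigma> j}"
  have fin: "finite ?A"
    by (rule finite_subset[of _ "{1..n} \<times> {1..n}"]) auto
  have "kendall_tau n \<pi> \<sigma> = (\<Sum>x\<in>?A. of_bool (\<pi> (fst x) > \<pi> (snd x)))"
    unfolding kendall_tau_def by (rule sum.cong) auto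
  also have "\<dots> = real (card (?A \<inter> {x. \<pi> (fst x) > \<pi> (snd x)}))"
    using fin by (simp add: sum.If_cases of_bool_def)
  also have "?A \<inter> {x. \<pi> (fst x) > \<pi> (snd x)} = discordant n \<pi> \<sigma>"
    by (auto simp: discordant_def)
  finally show ?thesis .
qed

lemma kendall_tau_refl: "kendall_tau n \<pi> \<pi> = 0"
proof -
  have "discordant n \<pi> \<pi> = {}" by (auto simp: discordant_def)
  then show ?thesis by (simp add: kendall_tau_eq_card)
qed

lemma kendall_tau_commute: "kendall_tau n \<pi> \<sigma> = kendall_tau n \<sigma> \<pi>"
proof -
  have "discordant n \<sigma> \<pi> = prod.swap ` discordant n \<pi> \<sigma>"
    by (auto simp: discordant_def image_iff)
  then show ?thesis by (simp add: kendall_tau_eq_card card_image)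
qed

text \<open>If \<pi> and \<sigma> order a pair differently, then \<tau>, which has no ties,
  disagrees on that pair with one of the two.\<close>

lemma kendall_tau_triangle:
  assumes "inj_on \<tau> {1..n}"
  shows "kendall_tau n \<pi> \<sigma> \<le> kendall_tau n \<pi> \<tau> + kendall_tau n \<tau> \<sigma>"
proof -
  have "discordant n \<pi> \<sigma> \<subseteq> discordant n \<pi> \<tau> \<union> discordant n \<tau> \<sigma>"
  proof
    fix x assume x: "x \<in> discordant n \<pi> \<sigma>"
    obtain i j where ij: "x = (i, j)" by force
    have "\<tau> i \<noteq> \<tau> j"
      using x ij assms by (auto simp: discordant_def dest: inj_onD)
    then show "x \<in> discordant n \<pi> \<tau> \<union> discordant n \<tau> \<sigma>"
      using x ij by (auto simp: discordant_def)
  qed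
  then have "card (discordant n \<pi> \<sigma>) \<le> card (discordant n \<pi> \<tau> \<union> discordant n \<tau> \<sigma>)"
    by (intro card_mono) (auto simp: finite_discordant)
  also have "\<dots> \<le> card (discordant n \<pi> \<tau>) + card (discordant n \<tau> \<sigma>)"
    by (rule card_Un_le)
  finally show ?thesis by (simp add: kendall_tau_eq_card)
qed

text \<open>Right invariance: composing with \<rho> only relabels positions, and
  \<open>map_prod \<rho> \<rho>\<close> matches the discordant pairs bijectively.\<close>

lemma kendall_tau_comp:
  assumes "\<rho> permutes {1..n}"
  shows "kendall_tau n (\<pi> \<circ> \<rho>) (\<sigma> \<circ> \<rho>) = kendall_tau n \<pi> \<sigma>"
proof -
  have "discordant n \<pi> \<sigma> = map_prod \<rho> \<rho> ` discordant n (\<pi> \<circ> \<rho>) (\<sigma> \<circ> \<rho>)"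
  proof (intro set_eqI iffI)
    fix x assume x: "x \<in> discordant n \<pi> \<sigma>"
    obtain i j where ij: "x = (i, j)" by force
    have inv: "\<rho> (inv \<rho> k) = k" for k by (rule permutes_inverses[OF assms])
    have "inv \<rho> k \<in> {1..n}" if "k \<in> {1..n}" for k
      using that permutes_in_image[OF permutes_inv[OF assms]] by blast
    then have "(inv \<rho> i, inv \<rho> j) \<in> discordant n (\<pi> \<circ> \<rho>) (\<sigma> \<circ> \<rho>)"
      using x by (simp add: discordant_def ij inv del: atLeastAtMost_iff)
    then have "map_prod \<rho> \<rho> (inv \<rho> i, inv \<rho> j) \<in> map_prod \<rho> \<rho> ` discordant n (\<pi> \<circ> \<rho>) (\<sigma> \<circ> \<rho>)"
      by (rule imageI)
    then show "x \<in> map_prod \<rho> \<rho> ` discordant n (\<pi> \<circ> \<rho>) (\<sigma> \<circ> \<rho>)"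
      by (simp only: map_prod_simp inv ij)
  next
    fix x assume "x \<in> map_prod \<rho> \<rho> ` discordant n (\<pi> \<circ> \<rho>) (\<sigma> \<circ> \<rho>)"
    then obtain i j where x: "x = (\<rho> i, \<rho> j)" and ij: "(i, j) \<in> discordant n (\<pi> \<circ> \<rho>) (\<sigma> \<circ> \<rho>)"
      by auto
    have "\<rho> k \<in> {1..n}" if "k \<in> {1..n}" for k
      using that permutes_in_image[OF assms] by blast
    then show "x \<in> discordant n \<pi> \<sigma>"
      using ij by (simp add: discordant_def x del: atLeastAtMost_iff)
  qed
  moreover have "inj (map_prod \<rho> \<rho>)"
    using permutes_inj[OF assms] by (simp add: prod.inj_map)
  ultimately show ?thesis
    by (simp add: kendall_tau_eq_card card_image inj_on_subset[OF _ subset_UNIV])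
qed

lemma finite_kt_ball: "finite (kt_ball n \<pi> r)"
proof -
  have "kt_ball n \<pi> r \<subseteq> {\<sigma>. \<sigma> permutes {1..n}}"
    by (auto simp: kt_ball_def perms_def)
  then show ?thesis using finite_permutations finite_subset by blast
qed

text \<open>By right invariance, composition with \<pi> on the right maps the ball around
  \<open>id\<close> bijectively onto the ball around \<pi>.\<close>

lemma card_kt_ball_eq:
  assumes "\<pi> \<in> perms n"
  shows "card (kt_ball n \<pi> r) = card (kt_ball n id r)"
proof -
  have p: "\<pi> permutes {1..n}" using assms by (simp add: perms_def)
  have "kt_ball n \<pi> r = (\<lambda>\<tau>. \<tau> \<circ> \<pi>) ` kt_ball n id r"
  proof (intro set_eqI iffI)
    fix \<sigma> assume s: "\<sigma> \<in> kt_ball n \<pi> r"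
    let ?t = "\<sigma> \<circ> inv \<pi>"
    have eq: "\<sigma> = ?t \<circ> \<pi>"
      by (auto simp: fun_eq_iff permutes_inverses[OF p])
    have "kendall_tau n id ?t = kendall_tau n \<pi> \<sigma>"
      using kendall_tau_comp[OF p, of id ?t] eq by simp
    moreover have "?t permutes {1..n}"
      using s permutes_compose[OF permutes_inv[OF p]] by (simp add: kt_ball_def perms_def)
    ultimately have "?t \<in> kt_ball n id r"
      using s by (simp add: kt_ball_def perms_def)
    then show "\<sigma> \<in> (\<lambda>\<tau>. \<tau> \<circ> \<pi>) ` kt_ball n id r" using eq by blast
  next
    fix \<sigma> assume "\<sigma> \<in> (\<lambda>\<tau>. \<tau> \<circ> \<pi>) ` kt_ball n id r"
    then show "\<sigma> \<in> kt_ball n \<pi> r"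
      using kendall_tau_comp[OF p, of id] permutes_compose[OF p]
      by (auto simp: kt_ball_def perms_def)
  qed
  moreover have "inj_on (\<lambda>\<tau>. \<tau> \<circ> \<pi>) (kt_ball n id r)"
  proof (rule inj_onI)
    fix \<sigma> \<tau> :: "nat \<Rightarrow> nat" assume "\<sigma> \<circ> \<pi> = \<tau> \<circ> \<pi>"
    then show "\<sigma> = \<tau>"
      using permutes_surj[OF p] by (metis surj_iff comp_assoc comp_id)
  qed
  ultimately show ?thesis by (simp add: card_image)
qed

section \<open>Lehmer codes\<close>

text \<open>Entry \<open>j\<close> counts the inversions whose later position is \<open>j\<close>.
  The restriction to \<open>{1..n}\<close> makes a code an element of an extensional product, so
  that codes can be counted.\<close>

definition lehmer :: "nat \<Rightarrow> (nat \<Rightarrow> nat) \<Rightarrow> nat \<Rightarrow> nat" where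
  "lehmer n \<sigma> = (\<lambda>j\<in>{1..n}. card {i\<in>{1..<j}. \<sigma> i > \<sigma> j})"

text \<open>A pair in \<open>discordant n id \<sigma>\<close> has the later position first; grouping
  the pairs by this component gives the entries of the code.\<close>

lemma sum_lehmer: "real (\<Sum>j\<in>{1..n}. lehmer n \<sigma> j) = kendall_tau n id \<sigma>"
proof -
  have "(\<Sum>j\<in>{1..n}. lehmer n \<sigma> j) = (\<Sum>j\<in>{1..n}. card {i\<in>{1..<j}. \<sigma> i > \<sigma> j})"
    by (rule sum.cong) (auto simp: lehmer_def)
  also have "\<dots> = card (Sigma {1..n} (\<lambda>j. {i\<in>{1..<j}. \<sigma> i > \<sigma> j}))"
    by (rule card_SigmaI[symmetric]) auto
  also have "Sigma {1..n} (\<lambda>j. {i\<in>{1..<j}. \<sigma> i > \<sigma> j}) = discordant n id \<sigma>"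
    by (auto simp: discordant_def)
  finally show ?thesis by (simp add: kendall_tau_eq_card)
qed

(* Read from position n downwards, the code determines \<sigma> j: it is the element of \<sigma> ` {1..j}
   that has exactly lehmer n \<sigma> j larger elements in that set. *)
lemma lehmer_inj: "inj_on (lehmer n) (perms n)"
proof (rule inj_onI)
  fix \<sigma> \<tau> assume s: "\<sigma> \<in> perms n" and t: "\<tau> \<in> perms n" and eq: "lehmer n \<sigma> = lehmer n \<tau>"
  have ps: "\<sigma> permutes {1..n}" and pt: "\<tau> permutes {1..n}"
    using s t by (auto simp: perms_def)
  have code: "card {x \<in> \<rho> ` {1..j}. x > \<rho> j} = lehmer n \<rho> j"
    if "\<rho> permutes {1..n}" "j \<in> {1..n}" for \<rho> j
  proof -
    have "{x \<in> \<rho> ` {1..j}. x > \<rho> j} = \<rho> ` {i\<in>{1..<j}. \<rho> i > \<rho> j}"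
      by (force simp: image_iff order_le_less)
    moreover have "inj_on \<rho> {i\<in>{1..<j}. \<rho> i > \<rho> j}"
      using permutes_inj[OF that(1)] inj_on_subset by blast
    ultimately show ?thesis using that(2) by (simp add: card_image lehmer_def)
  qed
  \<comment> \<open>If \<open>\<alpha> j < \<beta> j\<close>, then \<open>\<beta> j\<close> itself
    lies above \<open>\<alpha> j\<close>, so strictly more elements of the common image lie above
    \<open>\<alpha> j\<close> than above \<open>\<beta> j\<close>.\<close>
  have not_less: "\<not> \<alpha> j < \<beta> j"
    if "\<alpha> ` {1..j} = \<beta> ` {1..j}" "j \<in> {1..n}"
      "card {x \<in> \<alpha> ` {1..j}. x > \<alpha> j} = card {x \<in> \<beta> ` {1..j}. x > \<beta> j}" for \<alpha> \<beta> :: "nat \<Rightarrow> nat" and j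
  proof
    assume "\<alpha> j < \<beta> j"
    moreover have "\<beta> j \<in> \<beta> ` {1..j}" using that(2) by auto
    ultimately have less: "{x \<in> \<beta> ` {1..j}. x > \<beta> j} \<subset> {x \<in> \<alpha> ` {1..j}. x > \<alpha> j}"
      unfolding that(1) by force
    have "card {x \<in> \<beta> ` {1..j}. x > \<beta> j} < card {x \<in> \<alpha> ` {1..j}. x > \<alpha> j}"
      using less by (intro psubset_card_mono) auto
    then show False using that(3) by simp
  qed
  have "\<forall>i\<in>{n - k<..n}. \<sigma> i = \<tau> i" if "k \<le> n" for k
    using that
  proof (induction k)
    case 0
    then show ?case by simp
  next
    case (Suc k)
    define j where "j = n - k"
    have j: "j \<in> {1..n}" using Suc.prems by (auto simp: j_def)
    have IH: "\<sigma> i = \<tau> i" if "i \<in> {j<..n}" for i using Suc that by (auto simp: j_def)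
    \<comment> \<open>The values at positions up to \<open>j\<close> are what the values at later
      positions leave over, and the latter agree by induction.\<close>
    have im: "\<rho> ` {1..j} = {1..n} - \<rho> ` {j<..n}" if "\<rho> permutes {1..n}" for \<rho>
    proof -
      have "{1..j} = {1..n} - {j<..n}" using j by auto
      then show ?thesis
        using image_set_diff[OF permutes_inj[OF that]] permutes_image[OF that] by metis
    qed
    have "\<sigma> ` {j<..n} = \<tau> ` {j<..n}" using IH by (intro image_cong) auto
    then have "\<sigma> ` {1..j} = \<tau> ` {1..j}" using im[OF ps] im[OF pt] by simp
    moreover have "card {x \<in> \<sigma> ` {1..j}. x > \<sigma> j} = card {x \<in> \<tau> ` {1..j}. x > \<tau> j}"
      using code[OF ps j] code[OF pt j] eq by simp
    ultimately have "\<sigma> j = \<tau> j"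
      using not_less[of \<sigma> j \<tau>] not_less[of \<tau> j \<sigma>] j by simp
    moreover have "{n - Suc k<..n} = insert j {j<..n}"
      using Suc.prems by (auto simp: j_def)
    ultimately show ?case using IH by simp
  qed
  from this[of n] have "\<sigma> i = \<tau> i" if "i \<in> {1..n}" for i using that by simp
  then show "\<sigma> = \<tau>"
    using permutes_not_in[OF ps] permutes_not_in[OF pt] by (metis ext)
qed

abbreviation codes :: "nat \<Rightarrow> (nat \<Rightarrow> nat) set" where
  "codes n \<equiv> Pi\<^sub>E {1..n} (\<lambda>i. {..<i})"

text \<open>By injectivity there are n! codes of permutations, and the box of admissible codes has 1
  * 2 * ... * n elements, so inclusion suffices.\<close>

lemma lehmer_image: "lehmer n ` perms n = codes n"
proof (rule card_subset_eq)
  show "finite (codes n)" by (intro finite_PiE) auto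
  show "lehmer n ` perms n \<subseteq> codes n"
  proof (intro image_subsetI PiE_I)
    fix \<sigma> :: "nat \<Rightarrow> nat" and j assume j: "j \<in> {1..n}"
    have "card {i\<in>{1..<j}. \<sigma> i > \<sigma> j} \<le> card {1..<j}" by (intro card_mono) auto
    then show "lehmer n \<sigma> j \<in> {..<j}" using j by (auto simp: lehmer_def)
  next
    fix \<sigma> :: "nat \<Rightarrow> nat" and j assume "j \<notin> {1..n}"
    then show "lehmer n \<sigma> j = undefined" by (auto simp: lehmer_def)
  qed
  have "card (lehmer n ` perms n) = card (perms n)" by (rule card_image[OF lehmer_inj])
  also have "\<dots> = fact n" unfolding perms_def by (rule card_permutations) auto
  also have "\<dots> = card (codes n)" by (simp add: card_PiE fact_prod)
  finally show "card (lehmer n ` perms n) = card (codes n)" .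
qed

lemma card_kt_ball_codes:
  assumes "\<pi> \<in> perms n"
  shows "card (kt_ball n \<pi> r) = card {a \<in> codes n. real (\<Sum>j\<in>{1..n}. a j) \<le> r}"
proof -
  have "lehmer n ` kt_ball n id r = {a \<in> codes n. real (\<Sum>j\<in>{1..n}. a j) \<le> r}"
    unfolding lehmer_image[symmetric] kt_ball_def using sum_lehmer by fastforce
  moreover have "inj_on (lehmer n) (kt_ball n id r)"
    by (rule inj_on_subset[OF lehmer_inj]) (auto simp: kt_ball_def)
  ultimately show ?thesis
    using card_kt_ball_eq[OF assms] by (metis card_image)
qed

section \<open>Volume of a ball\<close>

text \<open>For \<open>0 < x < 1\<close>, each code of total at most \<open>k\<close> has weight at
  least \<open>x powr k\<close>, where a code of total \<open>t\<close> has weight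
  \<open>x ^ t\<close>. The weights of all codes sum to a product of truncated geometric
  series.\<close>

lemma card_kt_ball_upper:
  assumes "\<pi> \<in> perms n" "0 < k" "1 \<le> n"
  shows "real (card (kt_ball n \<pi> k)) \<le> exp (real n) * (1 + k / n) ^ n"
proof -
  \<comment> \<open>the minimizer of \<open>x powr (- k) / (1 - x) ^ n\<close>\<close>
  define x where "x = k / (n + k)"
  have x: "0 < x" "x < 1" and x1: "1 / (1 - x) = 1 + k / n" and x2: "1 / x = 1 + n / k"
    using assms by (auto simp: x_def field_simps)
  let ?B = "{a \<in> codes n. real (\<Sum>j\<in>{1..n}. a j) \<le> k}"
  have fin: "finite (codes n)" by (intro finite_PiE) auto
  have "real (card ?B) * x powr k = (\<Sum>a\<in>?B. x powr k)" by simp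
  also have "\<dots> \<le> (\<Sum>a\<in>?B. x ^ (\<Sum>j\<in>{1..n}. a j))"
  proof (rule sum_mono)
    fix a assume "a \<in> ?B"
    then have "x powr k \<le> x powr real (\<Sum>j\<in>{1..n}. a j)" using x by (intro powr_mono') auto
    then show "x powr k \<le> x ^ (\<Sum>j\<in>{1..n}. a j)" using x(1) by (simp only: powr_realpow)
  qed
  also have "\<dots> \<le> (\<Sum>a\<in>codes n. x ^ (\<Sum>j\<in>{1..n}. a j))"
    using fin x by (intro sum_mono2) auto
  also have "\<dots> = (\<Sum>a\<in>codes n. \<Prod>j\<in>{1..n}. x ^ a j)" by (simp add: power_sum)
  also have "\<dots> = (\<Prod>j\<in>{1..n}. \<Sum>i<j. x ^ i)" by (rule prod_sum_PiE[symmetric]) auto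
  also have "\<dots> \<le> (\<Prod>j\<in>{1..n}. 1 / (1 - x))"
  proof (intro prod_mono conjI)
    fix j
    show "(\<Sum>i<j. x ^ i) \<le> 1 / (1 - x)"
      using x by (simp add: sum_gp_strict divide_right_mono)
  qed (use x in \<open>auto intro: sum_nonneg\<close>)
  also have "\<dots> = (1 + k / n) ^ n" by (simp add: x1)
  finally have main: "real (card ?B) * x powr k \<le> (1 + k / n) ^ n" .
  \<comment> \<open>The reciprocal of \<open>x powr k\<close> is (1 + n/k)^k, which is at most e^n;
    this is the source of the exponential factor.\<close>
  have "k * ln (1 / x) \<le> k * (n / k)"
    unfolding x2 using assms by (intro mult_left_mono ln_add_one_self_le_self) auto
  then have "- (k * ln x) \<le> n" using x assms by (simp add: ln_div)
  then have "1 \<le> exp (real n) * x powr k"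
    using x by (simp add: powr_def flip: exp_add)
  then have "real (card ?B) * 1 \<le> real (card ?B) * (exp (real n) * x powr k)"
    by (intro mult_left_mono) auto
  also have "\<dots> \<le> exp (real n) * (1 + k / n) ^ n"
    using mult_left_mono[OF main, of "exp (real n)"] by (simp add: mult_ac)
  finally show ?thesis using card_kt_ball_codes[OF assms(1)] by simp
qed

text \<open>A weak form of Stirling's formula: the term of index \<open>p\<close> in the exponential
  series at \<open>p\<close> is at most the whole sum.\<close>

lemma power_self_le_exp_fact: "real p ^ p \<le> exp (real p) * fact p"
proof -
  have "(\<Sum>i\<in>{p}. inverse (fact i) *\<^sub>R real p ^ i) \<le> exp (real p)"
    unfolding exp_def by (rule sum_le_suminf) (use summable_exp[of "real p"] in auto)
  then show ?thesis by (simp add: field_simps)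
qed

text \<open>Codes with all entries at most \<lfloor>m/n\<rfloor> have total at most
  \<open>m\<close>. With p = \<lfloor>m/n\<rfloor> + 1 there are p! p^(n-p) of them, which is at
  least p^n e^(-p).\<close>

lemma card_kt_ball_lower:
  assumes "\<pi> \<in> perms n" "0 < m" "1 \<le> n" "m / n + 1 \<le> n"
  shows "(m / n) ^ n * exp (- (m / n + 1)) \<le> real (card (kt_ball n \<pi> m))"
proof -
  define q where "q = nat \<lfloor>m / n\<rfloor>"
  define p where "p = q + 1"
  have "m / n \<ge> 0" using assms by simp
  then have q: "real q \<le> m / n" "m / n < real q + 1" by (auto simp: q_def)
  \<comment> \<open>This is where \<open>m / n + 1 \<le> n\<close> enters: the positions split at
    \<open>p\<close>, so \<open>p\<close> must not exceed \<open>n\<close>.\<close>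
  then have "real p \<le> n" unfolding p_def using assms(4) by simp
  with q have p: "p \<le> n" "1 \<le> p" "m / n \<le> p" "p \<le> m / n + 1" "real n * q \<le> m"
    using assms by (auto simp: p_def field_simps)
  let ?C = "Pi\<^sub>E {1..n} (\<lambda>i. {..<min i p})"
  let ?B = "{a \<in> codes n. real (\<Sum>j\<in>{1..n}. a j) \<le> m}"
  have sub: "?C \<subseteq> ?B"
  proof (intro subsetI CollectI conjI)
    fix a assume a: "a \<in> ?C"
    then show "a \<in> codes n" by (auto simp: PiE_iff)
    have "(\<Sum>j\<in>{1..n}. a j) \<le> (\<Sum>j\<in>{1..n}. q)"
      using a by (intro sum_mono) (auto simp: PiE_iff p_def less_Suc_eq_le)
    then have "real (\<Sum>j\<in>{1..n}. a j) \<le> real (n * q)" by (simp only: of_nat_le_iff) simp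
    then show "real (\<Sum>j\<in>{1..n}. a j) \<le> m" using p(5) by simp
  qed
  \<comment> \<open>Up to position \<open>p\<close> the constraint \<open>a i < i\<close> is the
    tighter one and yields p!; after it the cap \<open>p\<close> takes over.\<close>
  have split: "{1..n} = {1..p} \<union> {p<..n}" using p by auto
  have "card ?C = (\<Prod>i\<in>{1..n}. min i p)" by (simp add: card_PiE)
  also have "\<dots> = (\<Prod>i\<in>{1..p}. min i p) * (\<Prod>i\<in>{p<..n}. min i p)"
    unfolding split by (rule prod.union_disjoint) auto
  also have "(\<Prod>i\<in>{1..p}. min i p) = fact p" unfolding fact_prod of_nat_id by (rule prod.cong) auto
  also have "(\<Prod>i\<in>{p<..n}. min i p) = p ^ (n - p)" by simp
  finally have C: "real (card ?C) = fact p * real p ^ (n - p)" by simp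
  \<comment> \<open>The power uses \<open>m / n \<le> p\<close> and the exponential uses
    \<open>p \<le> m / n + 1\<close>.\<close>
  have "(m / n) ^ n * exp (- (m / n + 1)) \<le> real p ^ n * exp (- real p)"
    using assms p by (intro mult_mono power_mono) auto
  also have "\<dots> \<le> real (card ?C)"
  proof -
    have "real p ^ n = real p ^ p * real p ^ (n - p)"
      using p by (simp flip: power_add)
    also have "\<dots> \<le> exp (real p) * fact p * real p ^ (n - p)"
      using power_self_le_exp_fact by (intro mult_right_mono) auto
    finally show ?thesis unfolding C by (simp add: exp_minus field_simps)
  qed
  also have "\<dots> \<le> real (card ?B)"
  proof (intro of_nat_mono card_mono sub)
    show "finite ?B" by (rule finite_subset[of _ "codes n"]) (auto intro: finite_PiE)
  qed
  finally show ?thesis using card_kt_ball_codes[OF assms(1)] by simp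
qed

section \<open>Volume comparison\<close>

text \<open>The balls of radius \<epsilon> around the points of an optimal cover exhaust the large
  ball, and all of them have the same size.\<close>

lemma card_kt_ball_le_covering:
  assumes "\<pi> \<in> perms n" "0 \<le> \<epsilon>"
  shows "card (kt_ball n \<pi> r) \<le>
    covering_number (kendall_tau n) (kt_ball n \<pi> r) \<epsilon> * card (kt_ball n \<pi> \<epsilon>)"
proof -
  obtain C where C: "is_cover (kendall_tau n) (kt_ball n \<pi> r) \<epsilon> C"
    "card C = covering_number (kendall_tau n) (kt_ball n \<pi> r) \<epsilon>"
    using covering_number_attained[OF finite_kt_ball] assms(2) by (metis kendall_tau_refl)
  have Cs: "C \<subseteq> kt_ball n \<pi> r" using C(1) by (auto simp: is_cover_def)
  have fin: "finite C" by (rule finite_subset[OF Cs finite_kt_ball])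
  have "kt_ball n \<pi> r \<subseteq> (\<Union>y\<in>C. kt_ball n y \<epsilon>)"
    using C(1) kendall_tau_commute by (force simp: is_cover_def kt_ball_def)
  then have "card (kt_ball n \<pi> r) \<le> card (\<Union>y\<in>C. kt_ball n y \<epsilon>)"
    using fin finite_kt_ball by (intro card_mono) auto
  also have "\<dots> \<le> (\<Sum>y\<in>C. card (kt_ball n y \<epsilon>))" by (rule card_UN_le[OF fin])
  also have "\<dots> = (\<Sum>y\<in>C. card (kt_ball n \<pi> \<epsilon>))"
    using Cs card_kt_ball_eq assms(1) by (intro sum.cong) (auto simp: kt_ball_def)
  finally show ?thesis using C(2) by simp
qed

text \<open>Balls of radius \<epsilon>/2 around the points of a packing are disjoint and of equal
  size, and the triangle inequality places them in the ball of radius r + \<epsilon>/2.\<close>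

lemma packing_mult_card_kt_ball_le:
  assumes "\<pi> \<in> perms n"
  shows "packing_number (kendall_tau n) (kt_ball n \<pi> r) \<epsilon> * card (kt_ball n \<pi> (\<epsilon> / 2))
    \<le> card (kt_ball n \<pi> (r + \<epsilon> / 2))"
proof -
  obtain P where P: "is_packing (kendall_tau n) (kt_ball n \<pi> r) \<epsilon> P"
    "card P = packing_number (kendall_tau n) (kt_ball n \<pi> r) \<epsilon>"
    using packing_number_attained[OF finite_kt_ball] by metis
  have Ps: "P \<subseteq> kt_ball n \<pi> r" using P(1) by (auto simp: is_packing_def)
  have fin: "finite P" by (rule finite_subset[OF Ps finite_kt_ball])
  have inj: "inj_on \<sigma> {1..n}" if "\<sigma> \<in> perms n" for \<sigma>
    using that permutes_inj_on unfolding perms_def by blast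
  have "card P * card (kt_ball n \<pi> (\<epsilon> / 2)) = (\<Sum>y\<in>P. card (kt_ball n \<pi> (\<epsilon> / 2)))" by simp
  also have "\<dots> = (\<Sum>y\<in>P. card (kt_ball n y (\<epsilon> / 2)))"
  proof (rule sum.cong)
    fix y assume "y \<in> P"
    then have "y \<in> perms n" using Ps by (auto simp: kt_ball_def)
    then show "card (kt_ball n \<pi> (\<epsilon> / 2)) = card (kt_ball n y (\<epsilon> / 2))"
      using card_kt_ball_eq assms by simp
  qed simp
  also have "\<dots> = card (\<Union>y\<in>P. kt_ball n y (\<epsilon> / 2))"
  proof (intro card_UN_disjoint[symmetric] ballI impI fin finite_kt_ball)
    fix x y assume xy: "x \<in> P" "y \<in> P" "x \<noteq> y"
    show "kt_ball n x (\<epsilon> / 2) \<inter> kt_ball n y (\<epsilon> / 2) = {}"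
    proof (rule equals0I)
      fix z assume z: "z \<in> kt_ball n x (\<epsilon> / 2) \<inter> kt_ball n y (\<epsilon> / 2)"
      then have "z \<in> perms n" by (simp add: kt_ball_def)
      then have "kendall_tau n x y \<le> kendall_tau n x z + kendall_tau n y z"
        using kendall_tau_triangle[OF inj] by (metis kendall_tau_commute)
      also have "\<dots> \<le> \<epsilon>" using z by (simp add: kt_ball_def)
      finally show False using P(1) xy by (force simp: is_packing_def)
    qed
  qed
  also have "\<dots> \<le> card (kt_ball n \<pi> (r + \<epsilon> / 2))"
  proof (intro card_mono finite_kt_ball UN_least subsetI)
    fix y z assume y: "y \<in> P" and z: "z \<in> kt_ball n y (\<epsilon> / 2)"
    have "y \<in> perms n" using y Ps by (auto simp: kt_ball_def)
    then have "kendall_tau n \<pi> z \<le> kendall_tau n \<pi> y + kendall_tau n y z"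
      using kendall_tau_triangle[OF inj] by blast
    then show "z \<in> kt_ball n \<pi> (r + \<epsilon> / 2)"
      using y z Ps by (force simp: kt_ball_def)
  qed
  finally show ?thesis using P(2) by simp
qed

section \<open>Passage to logarithms and accounting for the constants\<close>

theorem proposition3:
  fixes n :: nat and \<pi> :: "nat \<Rightarrow> nat" and r \<epsilon> :: real
  assumes "n \<ge> 2"
    and "\<pi> \<in> perms n"
    and "0 < r" and "r \<le> real (n choose 2)"
    and "0 < \<epsilon>" and "\<epsilon> < r"
  shows "real n * ln (r / (real n + \<epsilon>)) - 2 * real n
           \<le> ln (real (covering_number (kendall_tau n) (kt_ball n \<pi> r) \<epsilon>)) \<and>
         ln (real (covering_number (kendall_tau n) (kt_ball n \<pi> r) \<epsilon>))
           \<le> ln (real (packing_number (kendall_tau n) (kt_ball n \<pi> r) \<epsilon>)) \<and>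
         ln (real (packing_number (kendall_tau n) (kt_ball n \<pi> r) \<epsilon>))
           \<le> real n * ln ((2 * real n + 2 * r) / \<epsilon>) + 2 * real n"
proof -
  define N where "N = covering_number (kendall_tau n) (kt_ball n \<pi> r) \<epsilon>"
  define D where "D = packing_number (kendall_tau n) (kt_ball n \<pi> r) \<epsilon>"
  define V where "V m = card (kt_ball n \<pi> m)" for m
  have n: "real n \<ge> 2" using assms(1) by simp
  have rn: "r \<le> real n * (real n - 1) / 2"
    using assms(1,4) by (simp add: choose_two real_of_nat_div)
  have Vpos: "V m > 0" if "m > 0" for m
  proof -
    have "\<pi> \<in> kt_ball n \<pi> m" using assms(2) that by (simp add: kt_ball_def kendall_tau_refl)
    then show ?thesis unfolding V_def using finite_kt_ball card_gt_0_iff by blast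
  qed
  have upper: "ln (V m) \<le> n + n * ln (1 + m / n)" if "m > 0" for m
  proof -
    have "ln (V m) \<le> ln (exp (real n) * (1 + m / n) ^ n)"
      using card_kt_ball_upper[OF assms(2) that] assms(1) Vpos[OF that] by (simp add: V_def)
    also have "\<dots> = n + n * ln (1 + m / n)"
      using that n by (subst ln_mult_pos) (auto simp: ln_realpow add_pos_nonneg)
    finally show ?thesis .
  qed
  have lower: "n * ln (m / n) - (m / n + 1) \<le> ln (V m)" if "m > 0" "m / n + 1 \<le> n" for m
  proof -
    have "n * ln (m / n) - (m / n + 1) = ln ((m / n) ^ n * exp (- (m / n + 1)))"
      using that n by (subst ln_mult_pos) (auto simp: ln_realpow)
    also have "\<dots> \<le> ln (V m)"
      using card_kt_ball_lower[OF assms(2) that(1) _ that(2)] that(1) n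
      by (subst ln_le_cancel_iff) (auto simp: V_def intro: Vpos[unfolded V_def])
    finally show ?thesis .
  qed
  have cov: "V r \<le> N * V \<epsilon>"
    unfolding V_def N_def using assms by (intro card_kt_ball_le_covering) auto
  have pack: "D * V (\<epsilon> / 2) \<le> V (r + \<epsilon> / 2)"
    unfolding V_def D_def using assms by (intro packing_mult_card_kt_ball_le) auto
  have ND: "N \<le> D"
    unfolding N_def D_def
    using assms by (intro covering_number_le_packing_number finite_kt_ball)
      (auto simp: kendall_tau_refl kendall_tau_commute)
  \<comment> \<open>Positivity allows the logarithms of the products in \<open>cov\<close> and
    \<open>pack\<close> to be split.\<close>
  have Npos: "N > 0" using cov Vpos[OF assms(3)] by (cases "N = 0") auto
  \<comment> \<open>The bound on \<open>r\<close> by the binomial coefficient makes the lower volume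
    estimate applicable at radius \<open>r\<close>, and at \<epsilon>/2 because \<epsilon> <
    r.\<close>
  have r1: "r / n \<le> (real n - 1) / 2" using rn n by (simp add: field_simps)
  have "r / n + 1 \<le> (real n - 1) / 2 + 1" using r1 by (rule add_right_mono)
  also have "\<dots> \<le> n" using n by (simp add: field_simps)
  finally have r2: "r / n + 1 \<le> n" .
  have "n * ln (r / n) - (r / n + 1) \<le> ln (V r)" using lower r2 assms(3) by blast
  also have "\<dots> \<le> ln (real (N * V \<epsilon>))"
    using cov Npos Vpos[OF assms(3)] Vpos[OF assms(5)]
    by (subst ln_le_cancel_iff) (auto simp del: of_nat_mult)
  also have "\<dots> = ln N + ln (V \<epsilon>)"
    using Npos Vpos[OF assms(5)] by (simp add: ln_mult_pos)
  also have "\<dots> \<le> ln N + (n + n * ln (1 + \<epsilon> / n))" using upper[OF assms(5)] by simp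
  \<comment> \<open>The loss of 2n is n from the upper volume estimate plus r/n + 1, which is at
    most n, from the lower one.\<close>
  finally have "n * (ln (r / n) - ln (1 + \<epsilon> / n)) - 2 * real n \<le> ln N"
    using r2 by (simp add: algebra_simps)
  moreover have "ln (r / n) - ln (1 + \<epsilon> / n) = ln (r / (n + \<epsilon>))"
  proof -
    have "1 + \<epsilon> / n = (n + \<epsilon>) / n" using n by (simp add: field_simps)
    then show ?thesis using n assms by (simp add: ln_div)
  qed
  ultimately have first: "n * ln (r / (n + \<epsilon>)) - 2 * real n \<le> ln N" by simp
  have "\<epsilon> / n \<le> r / n" using assms by (intro divide_right_mono) auto
  from order_trans[OF this r1] have e1: "(\<epsilon> / 2) / n \<le> (real n - 1) / 4"
    using n by (simp add: field_simps)
  have "(\<epsilon> / 2) / n + 1 \<le> (real n - 1) / 4 + 1" using e1 by (rule add_right_mono)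
  also have "\<dots> \<le> n" using n by (simp add: field_simps)
  finally have e2: "(\<epsilon> / 2) / n + 1 \<le> n" .
  have "ln D + (n * ln ((\<epsilon> / 2) / n) - ((\<epsilon> / 2) / n + 1)) \<le> ln D + ln (V (\<epsilon> / 2))"
    using lower[OF _ e2] assms(5) by simp
  also have "\<dots> = ln (real (D * V (\<epsilon> / 2)))"
    using Npos ND Vpos[of "\<epsilon> / 2"] assms(5) by (simp add: ln_mult_pos)
  also have "\<dots> \<le> ln (V (r + \<epsilon> / 2))"
    using pack Npos ND Vpos[of "\<epsilon> / 2"] Vpos[of "r + \<epsilon> / 2"] assms
    by (subst ln_le_cancel_iff) (auto simp del: of_nat_mult)
  also have "\<dots> \<le> n + n * ln (1 + (r + \<epsilon> / 2) / n)" using upper assms by simp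
  finally have D1: "ln D \<le> n + n * (ln (1 + (r + \<epsilon> / 2) / n) - ln ((\<epsilon> / 2) / n)) + ((\<epsilon> / 2) / n + 1)"
    by (simp add: algebra_simps)
  have "ln (1 + (r + \<epsilon> / 2) / n) - ln ((\<epsilon> / 2) / n) = ln ((1 + (r + \<epsilon> / 2) / n) / ((\<epsilon> / 2) / n))"
  proof -
    have "1 + (r + \<epsilon> / 2) / n > 0" using n assms by (intro add_pos_pos) auto
    moreover have "(\<epsilon> / 2) / n > 0" using n assms by simp
    ultimately show ?thesis by (rule ln_divide_pos[symmetric])
  qed
  \<comment> \<open>The quotient is (2n + 2r + \<epsilon>)/\<epsilon>. Factoring out the target (2n
    + 2r)/\<epsilon> leaves a correction of the form 1 + t, whose logarithm is at most t.\<close>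
  also have "(1 + (r + \<epsilon> / 2) / n) / ((\<epsilon> / 2) / n)
      = (2 * real n + 2 * r) / \<epsilon> * (1 + \<epsilon> / (2 * real n + 2 * r))"
  proof -
    define s where "s = 2 * real n + 2 * r"
    have "s > 0" using n assms by (simp add: s_def)
    have "(1 + (r + \<epsilon> / 2) / n) / ((\<epsilon> / 2) / n) = (s + \<epsilon>) / \<epsilon>"
      using n assms by (simp add: s_def field_simps)
    also have "\<dots> = s / \<epsilon> * (1 + \<epsilon> / s)"
      using assms \<open>s > 0\<close> by (simp add: field_simps)
    finally show ?thesis by (simp add: s_def)
  qed
  also have "ln \<dots> = ln ((2 * real n + 2 * r) / \<epsilon>) + ln (1 + \<epsilon> / (2 * real n + 2 * r))"
    using n assms by (intro ln_mult_pos) (auto intro!: divide_pos_pos add_pos_pos)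
  also have "\<dots> \<le> ln ((2 * real n + 2 * r) / \<epsilon>) + \<epsilon> / (2 * real n + 2 * r)"
    using n assms by (intro add_left_mono ln_add_one_self_le_self) auto
  finally have "n * (ln (1 + (r + \<epsilon> / 2) / n) - ln ((\<epsilon> / 2) / n))
      \<le> n * (ln ((2 * real n + 2 * r) / \<epsilon>) + \<epsilon> / (2 * real n + 2 * r))"
    by (intro mult_left_mono) auto
  moreover have "n * (\<epsilon> / (2 * real n + 2 * r)) \<le> (real n - 1) / 2"
  proof -
    have "n * \<epsilon> \<le> n * r" using assms by (intro mult_left_mono) auto
    \<comment> \<open>The right side minus the left is n(n-1) - r, nonnegative by the bound on
      \<open>r\<close>.\<close>
    also have "\<dots> \<le> (real n - 1) * (n + r)"
    proof -
      have "r \<le> real n * (real n - 1)" using rn n assms by simp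
      then show ?thesis by (simp add: algebra_simps)
    qed
    finally have "n * \<epsilon> \<le> (real n - 1) * (n + r)" .
    then show ?thesis using n assms by (simp add: field_simps)
  qed
  \<comment> \<open>Besides the n from the upper estimate, the losses are at most (n-1)/4 + 1 from
    the lower estimate and (n-1)/2 from the correction, together at most n.\<close>
  ultimately have "ln D \<le> n * ln ((2 * real n + 2 * r) / \<epsilon>) + 2 * real n"
    using D1 e1 n by (simp add: distrib_left)
  moreover have "ln N \<le> ln D" using ND Npos by simp
  ultimately show ?thesis using first unfolding N_def D_def by blast
qed

end
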